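(* Let $\mathcal{V}$ be a finite node set with $|\mathcal{V}|\ge 2$, and fix a time $t$ and temperature schedule $\mathcal{T}_t$. Let $\mathcal{L}^{\mathrm{multi}}_{\mathcal{T}_t}\in\mathbb{R}^{|\mathcal{V}|\times|\mathcal{V}|}$ be the multimodal graph Laplacian, a symmetric positive semidefinite matrix with eigenvalues $0=\lambda_1(t)\le\lambda_2(t)\le\dots\le\lambda_{|\mathcal{V}|}(t)=:\lambda_{\max}(t)$ and corresponding orthonormal eigenvectors $u_1(t),\dots,u_{|\mathcal{V}|}(t)$. Let $c_{x,\mathcal{K}}(t)\in\mathbb{R}^{|\mathcal{V}|}$ be the degree-matched, null-mode-projected contrast vector defined in the context, so that $c_{x,\mathcal{K}}(t)\perp u_1(t)$. Then for every diffusion time $\tau>0$, $$\big\langle c_{x,\mathcal{K}}(t),\exp\!\big(-2\tau\mathcal{L}^{\mathrm{multi}}_{\mathcal{T}_t}\big)c_{x,\mathcal{K}}(t)\big\rangle=\sum_{i=2}^{|\mathcal{V}|}e^{-2\tau\lambda_i(t)}\big|\langle u_i(t),c_{x,\mathcal{K}}(t)\rangle\big|^2$$ and $$e^{-2\tau\lambda_{\max}(t)}\|c_{x,\mathcal{K}}(t)\|^2\;\le\;\big\langle c_{x,\mathcal{K}}(t),\exp\!\big(-2\tau\mathcal{L}^{\mathrm{multi}}_{\mathcal{T}_t}\big)c_{x,\mathcal{K}}(t)\big\rangle\;\le\;e^{-2\tau\lambda_2(t)}\|c_{x,\mathcal{K}}(t)\|^2 .$$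
   Context: The multimodal Laplacian is a nonnegative combination $\mathcal{L}^{\mathrm{multi}}_{\mathcal{T}_t}=\sum_{*}\mathrm{coeff}_*\,\mathcal{L}^{( * )}_{\mathcal{T}_t}$, with $\mathrm{coeff}_*\ge0$, over finitely many blocks $*$ (one intra-modal block per modality, one cross-modal block per pair of modalities, and one joint block), each $\mathcal{L}^{( * )}_{\mathcal{T}_t}$ being a symmetric positive semidefinite (normalized hypergraph) Laplacian on the same node set $\mathcal{V}$. It is a standing assumption that the smallest eigenvalue of $\mathcal{L}^{\mathrm{multi}}_{\mathcal{T}_t}$ is $\lambda_1(t)=0$. Contrast vector. Let $\mathcal{D}=\mathcal{D}^{\mathrm{multi}}_{\mathcal{T}_t}$ be the diagonal matrix, with nonnegative entries, of node degrees of the graph. Let $\mathsf{v}_x\in\mathcal{V}$ be the node representing the output $x$, let $\mathcal{K}\subseteq\mathcal{V}$ be the set of nodes representing admissible outputs, and let $\pi_{\mathcal{K}}$ be a probability vector supported on $\mathcal{K}$ satisfying the degree-matching condition $\sum_{\mathsf{v}\in\mathcal{K}}\pi_{\mathcal{K}}(\mathsf{v})\,\mathcal{D}_{\mathsf{v}\mathsf{v}}=\mathcal{D}_{\mathsf{v}_x\mathsf{v}_x}$. With $\delta_{\mathsf{v}_x}$ the standard basis vector at $\mathsf{v}_x$, set $c^{\mathrm{raw}}_{x,\mathcal{K}}(t)=\mathcal{D}^{1/2}(\delta_{\mathsf{v}_x}-\pi_{\mathcal{K}})\in\mathbb{R}^{|\mathcal{V}|}$ and $$c_{x,\mathcal{K}}(t)=\big(\mathbf{I}-u_1(t)u_1(t)^{\top}\big)c^{\mathrm{raw}}_{x,\mathcal{K}}(t).$$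 Inner products and norms are Euclidean on $\mathbb{R}^{|\mathcal{V}|}$, and $\exp$ is the matrix exponential. *)

theory Defs
  imports "HOL-Analysis.Analysis"
begin

section \<open>Matrix exponential\<close>

text \<open>The class operations \<open>*\<close> and \<open>^\<close> on \<open>real^'n^'n\<close> act entrywise, so powers with respect to
  the matrix product \<open>**\<close> need their own definition, and \<open>exp\<close> from \<open>real_normed_algebra_1\<close>
  is not available.\<close>

primrec matrix_pow :: "real^'n^'n \<Rightarrow> nat \<Rightarrow> real^'n^'n" where
  "matrix_pow A 0 = mat 1"
| "matrix_pow A (Suc k) = A ** matrix_pow A k"

definition matrix_exp :: "real^'n^'n \<Rightarrow> real^'n^'n" where
  "matrix_exp A = (\<Sum>k. (1 / fact k) *\<^sub>R matrix_pow A k)"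

lemma matrix_pow_entry_bound:
  fixes A :: "real^'n^'n"
  shows "\<bar>matrix_pow A k $ i $ j\<bar> \<le> (real CARD('n) * norm A) ^ k"
proof (induction k arbitrary: i j)
  case 0
  then show ?case by (simp add: mat_def)
next
  case (Suc k)
  have entry: "\<bar>A $ i $ l\<bar> \<le> norm A" for l
    using Finite_Cartesian_Product.norm_nth_le[of "A $ i" l]
      Finite_Cartesian_Product.norm_nth_le[of A i] by simp
  have "\<bar>matrix_pow A (Suc k) $ i $ j\<bar> \<le> (\<Sum>l\<in>UNIV. \<bar>A $ i $ l\<bar> * \<bar>matrix_pow A k $ l $ j\<bar>)"
    by (simp add: matrix_matrix_mult_def flip: abs_mult)
  also have "\<dots> \<le> (\<Sum>l\<in>(UNIV::'n set). norm A * (real CARD('n) * norm A) ^ k)"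
    by (intro sum_mono mult_mono entry Suc.IH) auto
  also have "\<dots> = (real CARD('n) * norm A) ^ Suc k"
    by simp
  finally show ?case .
qed

lemma matrix_exp_sums: "(\<lambda>k. (1 / fact k) *\<^sub>R matrix_pow A k) sums matrix_exp A"
  for A :: "real^'n^'n"
proof -
  let ?b = "real CARD('n) * norm A"
  let ?c = "real CARD('n) * real CARD('n)"
  have "norm (matrix_pow A k) \<le> ?c * ?b ^ k" for k
  proof -
    have "norm (matrix_pow A k) \<le> (\<Sum>i\<in>UNIV. norm (matrix_pow A k $ i))"
      unfolding norm_vec_def by (rule L2_set_le_sum) simp
    also have "\<dots> \<le> (\<Sum>i\<in>(UNIV::'n set). \<Sum>j\<in>(UNIV::'n set). \<bar>matrix_pow A k $ i $ j\<bar>)"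
      by (intro sum_mono norm_le_l1_cart)
    also have "\<dots> \<le> (\<Sum>i\<in>(UNIV::'n set). \<Sum>j\<in>(UNIV::'n set). ?b ^ k)"
      by (intro sum_mono matrix_pow_entry_bound)
    finally show ?thesis by simp
  qed
  then have "norm ((1 / fact k) *\<^sub>R matrix_pow A k) \<le> ?c * (?b ^ k /\<^sub>R fact k)" for k
    by (simp add: field_simps)
  moreover have "summable (\<lambda>k. ?c * (?b ^ k /\<^sub>R fact k))"
    by (intro summable_mult summable_exp_generic)
  ultimately have "summable (\<lambda>k. (1 / fact k) *\<^sub>R matrix_pow A k)"
    by (rule summable_comparison_test'[rotated])
  then show ?thesis
    unfolding matrix_exp_def by (rule summable_sums)
qed


section \<open>Symmetric positive semidefinite matrices and ordered eigensystems\<close>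

definition sym_psd :: "real^'n^'n \<Rightarrow> bool" where
  "sym_psd A \<longleftrightarrow> transpose A = A \<and> (\<forall>x. 0 \<le> x \<bullet> (A *v x))"

text \<open>Indices run over \<open>1, \<dots>, CARD('n)\<close>; since there are \<open>CARD('n)\<close> orthonormal eigenvectors,
  \<open>lam\<close> lists all eigenvalues of \<open>A\<close> with multiplicity.\<close>

definition ordered_eigensystem ::
    "real^'n^'n \<Rightarrow> (nat \<Rightarrow> real) \<Rightarrow> (nat \<Rightarrow> real^'n) \<Rightarrow> bool" where
  "ordered_eigensystem A lam u \<longleftrightarrow>
     (\<forall>i\<in>{1..CARD('n)}. A *v u i = lam i *\<^sub>R u i) \<and>
     (\<forall>i\<in>{1..CARD('n)}. \<forall>j\<in>{1..CARD('n)}. u i \<bullet> u j = (if i = j then 1 else 0)) \<and>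
     mono_on {1..CARD('n)} lam"


section \<open>The multimodal Laplacian\<close>

text \<open>A cross-modal block is indexed by an unordered pair of distinct modalities.\<close>

datatype 'm block = Intra 'm | Cross "'m set" | Joint

definition blocks :: "'m set \<Rightarrow> 'm block set" where
  "blocks M = Intra ` M \<union> Cross ` {P. P \<subseteq> M \<and> card P = 2} \<union> {Joint}"

definition multimodal_laplacian ::
    "'m set \<Rightarrow> ('m block \<Rightarrow> real) \<Rightarrow> ('m block \<Rightarrow> real^'n^'n) \<Rightarrow> real^'n^'n" where
  "multimodal_laplacian M coef Lblk = (\<Sum>b\<in>blocks M. coef b *\<^sub>R Lblk b)"

lemma sym_psd_multimodal_laplacian:
  assumes "\<And>b. b \<in> blocks M \<Longrightarrow> 0 \<le> coef b" "\<And>b. b \<in> blocks M \<Longrightarrow> sym_psd (Lblk b)"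
  shows "sym_psd (multimodal_laplacian M coef Lblk)"
proof -
  have "sym_psd (\<Sum>b\<in>B. coef b *\<^sub>R Lblk b)" if "B \<subseteq> blocks M" for B
    using that
  proof (induction B rule: infinite_finite_induct)
    case (insert b B)
    then show ?case
      using assms[of b]
      by (simp add: sym_psd_def transpose_def vec_eq_iff matrix_vector_mult_add_rdistrib
          inner_add_right flip: scaleR_matrix_vector_assoc)
  qed (auto simp: sym_psd_def transpose_def vec_eq_iff)
  then show ?thesis by (simp add: multimodal_laplacian_def)
qed


section \<open>The contrast vector\<close>

definition degree_matrix :: "real^'n^'n \<Rightarrow> bool" where
  "degree_matrix D \<longleftrightarrow> (\<forall>i j. i \<noteq> j \<longrightarrow> D $ i $ j = 0) \<and> (\<forall>i. 0 \<le> D $ i $ i)"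

definition diag_sqrt :: "real^'n^'n \<Rightarrow> real^'n^'n" where
  "diag_sqrt D = (\<chi> i j. if i = j then sqrt (D $ i $ i) else 0)"

definition prob_vector_on :: "'n set \<Rightarrow> real^'n \<Rightarrow> bool" where
  "prob_vector_on K p \<longleftrightarrow> (\<forall>v. 0 \<le> p $ v) \<and> (\<forall>v. v \<notin> K \<longrightarrow> p $ v = 0) \<and> (\<Sum>v\<in>UNIV. p $ v) = 1"

definition degree_matched :: "real^'n^'n \<Rightarrow> 'n \<Rightarrow> 'n set \<Rightarrow> real^'n \<Rightarrow> bool" where
  "degree_matched D vx K p \<longleftrightarrow> (\<Sum>v\<in>K. p $ v * D $ v $ v) = D $ vx $ vx"

definition raw_contrast :: "real^'n^'n \<Rightarrow> 'n \<Rightarrow> real^'n \<Rightarrow> real^'n" where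
  "raw_contrast D vx p = diag_sqrt D *v (axis vx 1 - p)"

text \<open>The type constraint makes the inner dimension of \<open>columnvector w ** rowvector w\<close> equal to one,
  so that this product is the outer product of \<open>w\<close> with itself.\<close>

definition contrast :: "real^'n^'n \<Rightarrow> real^'n \<Rightarrow> 'n \<Rightarrow> real^'n \<Rightarrow> real^'n" where
  "contrast D w vx p =
     (mat 1 - (columnvector w :: real^1^'n) ** rowvector w) *v raw_contrast D vx p"

lemma contrast_eq:
  fixes D :: "real^'n^'n"
  shows "contrast D w vx p = raw_contrast D vx p - (w \<bullet> raw_contrast D vx p) *\<^sub>R w"
proof -
  have "((columnvector w :: real^1^'n) ** rowvector w) *v y = (w \<bullet> y) *\<^sub>R w" for w y :: "real^'n"
    by (simp add: vec_eq_iff matrix_vector_mult_def matrix_matrix_mult_def columnvector_def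
        rowvector_def inner_vec_def sum_distrib_left mult_ac)
  moreover have "(A - B) *v y = A *v y - B *v y" for A B :: "real^'n^'n" and y
    by (rule matrix_vector_mult_diff_rdistrib)
  ultimately show ?thesis
    by (simp only: contrast_def matrix_vector_mul_lid)
qed

lemma contrast_orthogonal: "w \<bullet> w = 1 \<Longrightarrow> contrast D w vx p \<bullet> w = 0"
  by (simp add: contrast_eq inner_diff_left) (simp add: inner_commute)

end

theory Submission
  imports Defs
begin

text \<open>The eigenvectors of \<open>L\<close> form an orthonormal basis, and the matrix
  exponential acts on each of them as multiplication by a scalar
  (\<open>matrix_exp_eigenvector\<close>). Expanding \<open>c\<close> in this basis
  (\<open>orthonormal_family_expansion\<close>) turns the quadratic form into a sum of squared
  coefficients weighted by \<open>exp (- 2 * \<tau> * lam t i)\<close>. The projection in the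
  contrast vector makes the first coefficient vanish, so only the modes from 2 on remain. Their
  weights lie between those of the largest and the second eigenvalue, and Parseval's identity sums
  the squared coefficients to the squared norm of \<open>c\<close>.\<close>

lemma matrix_pow_eigenvector:
  assumes "A *v x = l *\<^sub>R x"
  shows "matrix_pow A k *v x = l ^ k *\<^sub>R x"
  by (induction k)
    (simp_all add: assms matrix_vector_mult_scaleR mult.commute flip: matrix_vector_mul_assoc)

text \<open>Evaluation of a matrix at a fixed vector is linear on a finite-dimensional space, hence
  bounded, so it may be applied to the exponential series term by term. On an eigenvector the result
  is the scalar exponential series times that vector.\<close>

lemma matrix_exp_eigenvector:
  fixes A :: "real^'n^'n"
  assumes "A *v x = l *\<^sub>R x"
  shows "matrix_exp A *v x = exp l *\<^sub>R x"
proof -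
  have "linear (\<lambda>B :: real^'n^'n. B *v x)"
    by (rule linearI)
      (simp_all add: matrix_vector_mult_add_rdistrib scaleR_matrix_vector_assoc)
  then have "bounded_linear (\<lambda>B :: real^'n^'n. B *v x)"
    by (simp add: linear_conv_bounded_linear)
  from bounded_linear.sums[OF this matrix_exp_sums[of A]]
  have "(\<lambda>k. (l ^ k /\<^sub>R fact k) *\<^sub>R x) sums (matrix_exp A *v x)"
    by (simp add: matrix_pow_eigenvector[OF assms] divide_inverse mult.commute
        flip: scaleR_matrix_vector_assoc)
  moreover have "(\<lambda>k. (l ^ k /\<^sub>R fact k) *\<^sub>R x) sums (exp l *\<^sub>R x)"
    by (intro sums_scaleR_left exp_converges)
  ultimately show ?thesis
    by (rule sums_unique2)
qed

text \<open>Orthonormal vectors are independent, so as many of them as the dimension span the space.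
  The residual of the expansion is orthogonal to each of them, hence to itself, and is therefore
  zero.\<close>

lemma orthonormal_family_expansion:
  fixes u :: "'i \<Rightarrow> 'a::euclidean_space"
  assumes fin: "finite I" and card: "card I = DIM('a)"
    and on: "\<And>i j. i \<in> I \<Longrightarrow> j \<in> I \<Longrightarrow> u i \<bullet> u j = (if i = j then 1 else 0)"
  shows "x = (\<Sum>i\<in>I. (u i \<bullet> x) *\<^sub>R u i)"
proof -
  \<comment> \<open>Equal vectors at distinct indices would give 1 = 0. Injectivity lets the image
    inherit the cardinality of \<open>I\<close>.\<close>
  have inj: "inj_on u I"
    by (rule inj_onI) (metis on zero_neq_one)
  have "pairwise orthogonal (u ` I)"
    by (auto simp: pairwise_def orthogonal_def on)
  moreover have "0 \<notin> u ` I"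
    using on by force
  ultimately have "independent (u ` I)"
    by (rule pairwise_orthogonal_independent)
  then have span: "span (u ` I) = UNIV"
    using card_ge_dim_independent[of "u ` I" UNIV] card card_image[OF inj] by auto
  define y where "y = x - (\<Sum>i\<in>I. (u i \<bullet> x) *\<^sub>R u i)"
  have "orthogonal y v" if "v \<in> u ` I" for v
    using that fin
    by (auto simp: y_def orthogonal_def inner_diff_left inner_sum_left on inner_commute[of x]
        if_distrib[of "\<lambda>r. _ * r"] cong: if_cong)
  then have "orthogonal y y"
    using orthogonal_to_span[of y "u ` I" y] by (simp add: span)
  then show ?thesis
    by (simp add: y_def orthogonal_def)
qed

lemma ordered_eigensystem_expansion:
  fixes A :: "real^'n^'n"
  assumes "ordered_eigensystem A lam u"
  shows "x = (\<Sum>i = 1..CARD('n). (u i \<bullet> x) *\<^sub>R u i)"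
  using assms by (intro orthonormal_family_expansion) (auto simp: ordered_eigensystem_def)

text \<open>Parseval's identity. Only one of the two factors in \<open>x \<bullet> x\<close> is
  expanded, which avoids a double sum.\<close>

lemma ordered_eigensystem_norm_power2:
  fixes A :: "real^'n^'n"
  assumes "ordered_eigensystem A lam u"
  shows "(norm x)\<^sup>2 = (\<Sum>i = 1..CARD('n). (u i \<bullet> x)\<^sup>2)"
proof -
  have "(norm x)\<^sup>2 = x \<bullet> (\<Sum>i = 1..CARD('n). (u i \<bullet> x) *\<^sub>R u i)"
    using ordered_eigensystem_expansion[OF assms, of x] by (simp add: power2_norm_eq_inner)
  then show ?thesis
    by (simp add: inner_sum_right inner_commute[of x] power2_eq_square)
qed

lemma ordered_eigensystem_matrix_exp:
  fixes A :: "real^'n^'n"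
  assumes "ordered_eigensystem A lam u"
  shows "x \<bullet> (matrix_exp (r *\<^sub>R A) *v x) = (\<Sum>i = 1..CARD('n). exp (r * lam i) * (u i \<bullet> x)\<^sup>2)"
proof -
  have "(r *\<^sub>R A) *v u i = (r * lam i) *\<^sub>R u i" if "i \<in> {1..CARD('n)}" for i
    using assms that by (simp add: ordered_eigensystem_def flip: scaleR_matrix_vector_assoc)
  then have eig: "matrix_exp (r *\<^sub>R A) *v u i = exp (r * lam i) *\<^sub>R u i"
    if "i \<in> {1..CARD('n)}" for i
    using that by (intro matrix_exp_eigenvector)
  have "matrix_exp (r *\<^sub>R A) *v x =
      matrix_exp (r *\<^sub>R A) *v (\<Sum>i = 1..CARD('n). (u i \<bullet> x) *\<^sub>R u i)"
    using ordered_eigensystem_expansion[OF assms, of x] by simp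
  also have "\<dots> = (\<Sum>i = 1..CARD('n). (u i \<bullet> x) *\<^sub>R (exp (r * lam i) *\<^sub>R u i))"
    \<comment> \<open>By linearity the exponential reaches each eigenvector separately, where
      \<open>eig\<close> replaces it by a scalar.\<close>
    unfolding linear_sum[OF matrix_vector_mul_linear]
    by (intro sum.cong refl) (simp only: matrix_vector_mult_scaleR eig)
  finally show ?thesis
    by (simp add: inner_sum_right inner_commute[of x] power2_eq_square mult_ac)
qed

theorem mainTheorem3:
  fixes t \<tau> :: real
    and T :: "real \<Rightarrow> 'temp"
    and M :: "'m set"
    and coef :: "'m block \<Rightarrow> real"
    and Lblk :: "'temp \<Rightarrow> 'm block \<Rightarrow> real^'n^'n"
    and D :: "'temp \<Rightarrow> real^'n^'n"
    and lam :: "real \<Rightarrow> nat \<Rightarrow> real"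
    and u :: "real \<Rightarrow> nat \<Rightarrow> real^'n"
    and vx :: 'n and K :: "'n set" and p :: "real^'n"
    and L :: "real^'n^'n" and c :: "real^'n"
  assumes nodes: "CARD('n) \<ge> 2"
    and modalities: "finite M"
    and coef_nonneg: "\<And>b. b \<in> blocks M \<Longrightarrow> coef b \<ge> 0"
    and block_psd: "\<And>b. b \<in> blocks M \<Longrightarrow> sym_psd (Lblk (T t) b)"
    and L: "L = multimodal_laplacian M coef (Lblk (T t))"
    and eigensystem: "ordered_eigensystem L (lam t) (u t)"
    and lam_1: "lam t 1 = 0"
    and degrees: "degree_matrix (D (T t))"
    and prob: "prob_vector_on K p"
    and matched: "degree_matched (D (T t)) vx K p"
    and c: "c = contrast (D (T t)) (u t 1) vx p"
    and tau: "\<tau> > 0"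
  shows "c \<bullet> (matrix_exp ((- 2 * \<tau>) *\<^sub>R L) *v c) =
           (\<Sum>i = 2..CARD('n). exp (- 2 * \<tau> * lam t i) * \<bar>u t i \<bullet> c\<bar>\<^sup>2) \<and>
         exp (- 2 * \<tau> * lam t CARD('n)) * (norm c)\<^sup>2 \<le> c \<bullet> (matrix_exp ((- 2 * \<tau>) *\<^sub>R L) *v c) \<and>
         c \<bullet> (matrix_exp ((- 2 * \<tau>) *\<^sub>R L) *v c) \<le> exp (- 2 * \<tau> * lam t 2) * (norm c)\<^sup>2"
proof -
  let ?N = "CARD('n)"
  let ?q = "c \<bullet> (matrix_exp ((- 2 * \<tau>) *\<^sub>R L) *v c)"
  have "u t 1 \<bullet> u t 1 = 1"
    using eigensystem nodes by (simp add: ordered_eigensystem_def)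
  then have perp: "u t 1 \<bullet> c = 0"
    unfolding c by (subst inner_commute) (rule contrast_orthogonal)
  have split: "{1..?N} = insert 1 {2..?N}"
    using nodes by auto
  \<comment> \<open>Dropping the null mode here as well as in \<open>form\<close> is what lets the
    second eigenvalue, rather than the first, govern the upper bound.\<close>
  have norm: "(norm c)\<^sup>2 = (\<Sum>i = 2..?N. (u t i \<bullet> c)\<^sup>2)"
    using ordered_eigensystem_norm_power2[OF eigensystem, of c] perp unfolding split by simp
  have form: "?q = (\<Sum>i = 2..?N. exp (- 2 * \<tau> * lam t i) * (u t i \<bullet> c)\<^sup>2)"
    using ordered_eigensystem_matrix_exp[OF eigensystem, of c "- 2 * \<tau>"] perp
    unfolding split by simp
  have mono: "mono_on {1..?N} (lam t)"
    using eigensystem by (simp add: ordered_eigensystem_def)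
  \<comment> \<open>The factor \<open>- 2 * \<tau>\<close> is negative, so the increasing order of
    the eigenvalues becomes a decreasing order of the weights.\<close>
  have lower: "exp (- 2 * \<tau> * lam t ?N) \<le> exp (- 2 * \<tau> * lam t i)"
    and upper: "exp (- 2 * \<tau> * lam t i) \<le> exp (- 2 * \<tau> * lam t 2)" if "i \<in> {2..?N}" for i
    using that tau mono_onD[OF mono, of i ?N] mono_onD[OF mono, of 2 i] by simp_all
  have "exp (- 2 * \<tau> * lam t ?N) * (norm c)\<^sup>2 \<le> ?q"
    unfolding form norm sum_distrib_left
    by (intro sum_mono mult_right_mono lower zero_le_power2)
  moreover have "?q \<le> exp (- 2 * \<tau> * lam t 2) * (norm c)\<^sup>2"
    unfolding form norm sum_distrib_left
    by (intro sum_mono mult_right_mono upper zero_le_power2)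
  ultimately show ?thesis
    using form by simp
qed

end
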